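(* Let $K$ be a field and $F$ a set of functions $f:K^{n}\to K$ (possibly with different $n$ for different $f$) containing a function which is not additively affine. Let $I,I'$ be sets, let $E\subset K^I$ and $E'\subset K^{I'}$ be linear subspaces, both containing the constant functions and both stable under $F$, and let $\varphi:E\to E'$ be a unital $F$-homomorphism. Then for any $n=1,2,\ldots$, any $S\subset K^n$ closed with respect to the topology on $K^n$ induced by $G(F)_n$, and any $\xi_1,\ldots,\xi_n\in E$: if $(\xi_1(t),\ldots,\xi_n(t))\in S$ for all $t\in I$, then $(\varphi(\xi_1)(t'),\ldots,\varphi(\xi_n)(t'))\in S$ for all $t'\in I'$.
   Context: A function $f:K^n\to K$ ($n\ge1$) is additively affine if it is the sum of a constant and a homomorphism of additive groups. A linear subspace $E\subset K^I$ is stable under $f$ (equivalently, $f$ operates on $E$) if for all $\xi_1,\ldots,\xi_n\in E$ the function $f(\xi_1,\ldots,\xi_n):t\mapsto f(\xi_1(t),\ldots,\xi_n(t))$ is in $E$; $E$ is stable under $F$ if it is stable under each $f\in F$. A unital $F$-homomorphism $\varphi:E\to E'$ is a $K$-linear map such that $\varphi(f(\xi_1,\ldots,\xi_n))=f(\varphi(\xi_1),\ldots,\varphi(\xi_n))$ for every $f\in F$, $f:K^n\to K$, and all $\xi_1,\ldots,\xi_n\in E$, and which maps the constant function $\mathbf 1$ on $I$ to the constant function $\mathbf 1$ on $I'$. An operating semigroup is a sequence of linear subspaces $G_n\subset K^{K^n}$, $n=1,2,\ldots$, such that $G_n$ contains the constants and the $n$ coordinate functions $K^n\to K$, and for all $m,n$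 every member of $G_m$ operates on $G_n$. $G(F)=(G(F)_n)_{n\ge1}$ is the operating semigroup generated by $F$, i.e. the smallest operating semigroup containing $F$ (each $f:K^n\to K$ in $F$ belonging to $G(F)_n$). For a linear subspace $E\subset K^X$ containing the constants, a subset $S\subset X$ is called $E$-closed if for every $t\in X\setminus S$ there is a $\xi\in E$ vanishing on $S$ with $\xi(t)\neq0$. If the union of any two $E$-closed sets is $E$-closed, the $E$-closed sets are the closed sets of a topology on $X$, called the topology induced by $E$. This is the case whenever $E$ is stable under some operation that is not additively affine; in particular it is so for $G(F)_n$ on $X=K^n$. *)

theory Defs
  imports "HOL-Analysis.Abstract_Topology" "HOL-Library.Function_Algebras"
begin

text \<open>
  For a set \<open>X\<close>, the space \<open>K\<^sup>X\<close> is represented by the total functions that vanish outside \<open>X\<close>;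
  it is a vector space under the pointwise operations. In particular \<open>K\<^sup>n\<close> is \<open>K\<^sup>X\<close> for
  \<open>X = {0, \<dots>, n - 1}\<close>, so coordinates are numbered from 0.
\<close>

definition functions_on :: "'x set \<Rightarrow> ('x \<Rightarrow> 'k::zero) set" where
  "functions_on X = {\<xi>. \<forall>x. x \<notin> X \<longrightarrow> \<xi> x = 0}"

abbreviation power_space :: "nat \<Rightarrow> (nat \<Rightarrow> 'k::zero) set" where
  "power_space n \<equiv> functions_on {..<n}"

definition on :: "'x set \<Rightarrow> ('x \<Rightarrow> 'k) \<Rightarrow> ('x \<Rightarrow> 'k::zero)" where
  "on X \<xi> = (\<lambda>x. if x \<in> X then \<xi> x else 0)"

definition fun_scale :: "'k \<Rightarrow> ('x \<Rightarrow> 'k) \<Rightarrow> ('x \<Rightarrow> 'k::field)" where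
  "fun_scale c \<xi> = (\<lambda>x. c * \<xi> x)"

global_interpretation fun_space: vector_space "fun_scale :: 'k::field \<Rightarrow> ('x \<Rightarrow> 'k) \<Rightarrow> _"
  by unfold_locales (auto simp: fun_scale_def fun_eq_iff algebra_simps)

definition linear_subspace :: "'x set \<Rightarrow> ('x \<Rightarrow> 'k::field) set \<Rightarrow> bool" where
  "linear_subspace X E \<longleftrightarrow> E \<subseteq> functions_on X \<and> fun_space.subspace E"

definition contains_constants :: "'x set \<Rightarrow> ('x \<Rightarrow> 'k::zero) set \<Rightarrow> bool" where
  "contains_constants X E \<longleftrightarrow> (\<forall>c. on X (\<lambda>x. c) \<in> E)"

text \<open>
  The functions \<open>\<xi>\<^sub>1, \<dots>, \<xi>\<^sub>n\<close> are given as a family \<open>\<xi>\<close> of which only the first \<open>n\<close> members matter;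
  \<open>tuple n \<xi> t\<close> is the point \<open>(\<xi>\<^sub>1(t), \<dots>, \<xi>\<^sub>n(t))\<close>.
\<close>

definition tuple :: "nat \<Rightarrow> (nat \<Rightarrow> 'x \<Rightarrow> 'k) \<Rightarrow> 'x \<Rightarrow> (nat \<Rightarrow> 'k::zero)" where
  "tuple n \<xi> t = on {..<n} (\<lambda>i. \<xi> i t)"

definition apply_op ::
  "'x set \<Rightarrow> nat \<Rightarrow> ((nat \<Rightarrow> 'k) \<Rightarrow> 'k) \<Rightarrow> (nat \<Rightarrow> 'x \<Rightarrow> 'k) \<Rightarrow> ('x \<Rightarrow> 'k::zero)" where
  "apply_op X n f \<xi> = on X (\<lambda>t. f (tuple n \<xi> t))"

definition operates_on ::
  "nat \<Rightarrow> ((nat \<Rightarrow> 'k) \<Rightarrow> 'k) \<Rightarrow> 'x set \<Rightarrow> ('x \<Rightarrow> 'k::zero) set \<Rightarrow> bool" where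
  "operates_on n f X E \<longleftrightarrow> (\<forall>\<xi>. (\<forall>i<n. \<xi> i \<in> E) \<longrightarrow> apply_op X n f \<xi> \<in> E)"

definition additively_affine :: "nat \<Rightarrow> ((nat \<Rightarrow> 'k) \<Rightarrow> 'k::ab_group_add) \<Rightarrow> bool" where
  "additively_affine n f \<longleftrightarrow> (\<exists>c h.
     (\<forall>x\<in>power_space n. \<forall>y\<in>power_space n. h (x + y) = h x + h y) \<and>
     (\<forall>x\<in>power_space n. f x = c + h x))"

text \<open>
  A set of functions \<open>K\<^sup>n \<rightarrow> K\<close> with varying \<open>n \<ge> 1\<close> is represented by the sequence of its subsets of
  \<open>n\<close>-ary functions. The component at 0 carries no meaning and is ignored throughout.
\<close>

type_synonym 'k operations = "nat \<Rightarrow> ((nat \<Rightarrow> 'k) \<Rightarrow> 'k) set"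

definition operation_set :: "'k::zero operations \<Rightarrow> bool" where
  "operation_set F \<longleftrightarrow> (\<forall>n\<ge>1. F n \<subseteq> functions_on (power_space n))"

definition stable_under ::
  "'k::zero operations \<Rightarrow> 'x set \<Rightarrow> ('x \<Rightarrow> 'k) set \<Rightarrow> bool" where
  "stable_under F X E \<longleftrightarrow> (\<forall>n\<ge>1. \<forall>f\<in>F n. operates_on n f X E)"

definition unital_hom ::
  "'k::field operations \<Rightarrow> 'x set \<Rightarrow> ('x \<Rightarrow> 'k) set \<Rightarrow> 'y set \<Rightarrow> ('y \<Rightarrow> 'k) set \<Rightarrow>
    (('x \<Rightarrow> 'k) \<Rightarrow> ('y \<Rightarrow> 'k)) \<Rightarrow> bool" where
  "unital_hom F X E Y E' \<phi> \<longleftrightarrow>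
     \<phi> ` E \<subseteq> E' \<and>
     (\<forall>\<xi>\<in>E. \<forall>\<eta>\<in>E. \<phi> (\<xi> + \<eta>) = \<phi> \<xi> + \<phi> \<eta>) \<and>
     (\<forall>c. \<forall>\<xi>\<in>E. \<phi> (fun_scale c \<xi>) = fun_scale c (\<phi> \<xi>)) \<and>
     (\<forall>n\<ge>1. \<forall>f\<in>F n. \<forall>\<xi>. (\<forall>i<n. \<xi> i \<in> E) \<longrightarrow>
        \<phi> (apply_op X n f \<xi>) = apply_op Y n f (\<lambda>i. \<phi> (\<xi> i))) \<and>
     \<phi> (on X (\<lambda>x. 1)) = on Y (\<lambda>y. 1)"

definition operating_semigroup :: "'k::field operations \<Rightarrow> bool" where
  "operating_semigroup G \<longleftrightarrow>
     (\<forall>n\<ge>1. linear_subspace (power_space n) (G n) \<and>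
        contains_constants (power_space n) (G n) \<and>
        (\<forall>i<n. on (power_space n) (\<lambda>x. x i) \<in> G n)) \<and>
     (\<forall>m\<ge>1. \<forall>n\<ge>1. \<forall>g\<in>G m. operates_on m g (power_space n) (G n))"

definition generated :: "'k::field operations \<Rightarrow> 'k operations" where
  "generated F n = \<Inter>{G n |G. operating_semigroup G \<and> (\<forall>m\<ge>1. F m \<subseteq> G m)}"

definition function_closed :: "'x set \<Rightarrow> ('x \<Rightarrow> 'k::zero) set \<Rightarrow> 'x set \<Rightarrow> bool" where
  "function_closed X E S \<longleftrightarrow>
     S \<subseteq> X \<and> (\<forall>t\<in>X - S. \<exists>\<xi>\<in>E. (\<forall>s\<in>S. \<xi> s = 0) \<and> \<xi> t \<noteq> 0)"

text \<open>
  Meaningful only if \<open>function_closed X E\<close> is preserved under binary unions; see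
  \<open>closedin_induced_topology\<close> and \<open>function_closed_Un\<close> below.
\<close>

definition induced_topology :: "'x set \<Rightarrow> ('x \<Rightarrow> 'k::zero) set \<Rightarrow> 'x topology" where
  "induced_topology X E = topology (\<lambda>U. U \<subseteq> X \<and> function_closed X E (X - U))"

lemma operating_semigroup_generated:
  assumes "operation_set F"
  shows "operating_semigroup (generated F)"
    and "\<And>n. 1 \<le> n \<Longrightarrow> F n \<subseteq> generated F n"
    and "\<And>G n. operating_semigroup G \<Longrightarrow> (\<And>m. 1 \<le> m \<Longrightarrow> F m \<subseteq> G m) \<Longrightarrow> generated F n \<subseteq> G n"
proof -
  define U :: "'a operations" where "U n = functions_on (power_space n)" for n
  have U: "operating_semigroup U" "\<And>m. 1 \<le> m \<Longrightarrow> F m \<subseteq> U m"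
    using assms
    by (auto simp: operating_semigroup_def U_def linear_subspace_def fun_space.subspace_def
        contains_constants_def operates_on_def apply_op_def functions_on_def on_def fun_scale_def
        operation_set_def)
  show least: "\<And>G n. operating_semigroup G \<Longrightarrow> (\<And>m. 1 \<le> m \<Longrightarrow> F m \<subseteq> G m) \<Longrightarrow>
      generated F n \<subseteq> G n"
    unfolding generated_def by blast
  show "\<And>n. 1 \<le> n \<Longrightarrow> F n \<subseteq> generated F n"
    unfolding generated_def by blast
  have sub: "generated F n \<subseteq> functions_on (power_space n)" for n
    using least[OF U] by (auto simp: U_def)
  have mem: "x \<in> generated F n \<longleftrightarrow>
      (\<forall>G. operating_semigroup G \<and> (\<forall>m\<ge>1. F m \<subseteq> G m) \<longrightarrow> x \<in> G n)" for x n
    unfolding generated_def by blast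
  have "fun_space.subspace (generated F n)" if "1 \<le> n" for n
  proof -
    have G: "fun_space.subspace (G n)" if "operating_semigroup G" for G :: "'a operations"
      using that \<open>1 \<le> n\<close> by (simp add: operating_semigroup_def linear_subspace_def)
    show ?thesis
      unfolding generated_def by (rule fun_space.subspace_Inter) (auto intro: G)
  qed
  then have "linear_subspace (power_space n) (generated F n)" if "1 \<le> n" for n
    using that sub by (simp add: linear_subspace_def)
  moreover have "contains_constants (power_space n) (generated F n)" if "1 \<le> n" for n
    using that by (simp add: contains_constants_def mem operating_semigroup_def)
  moreover have "on (power_space n) (\<lambda>x. x i) \<in> generated F n" if "1 \<le> n" "i < n" for n i
    using that by (simp add: mem operating_semigroup_def)
  moreover have "operates_on m g (power_space n) (generated F n)"
    if "1 \<le> m" "1 \<le> n" "g \<in> generated F m" for m n g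
    unfolding operates_on_def mem
  proof (intro allI impI)
    fix \<xi> :: "nat \<Rightarrow> (nat \<Rightarrow> 'a) \<Rightarrow> 'a" and G :: "'a operations"
    assume \<xi>: "\<forall>i<m. \<forall>G. operating_semigroup G \<and> (\<forall>m\<ge>1. F m \<subseteq> G m) \<longrightarrow> \<xi> i \<in> G n"
      and G: "operating_semigroup G \<and> (\<forall>m\<ge>1. F m \<subseteq> G m)"
    have "g \<in> G m"
      using that(3) G unfolding mem by simp
    then have "operates_on m g (power_space n) (G n)"
      using G that(1,2) unfolding operating_semigroup_def by simp
    moreover have "\<forall>i<m. \<xi> i \<in> G n"
      using \<xi> G by simp
    ultimately show "apply_op (power_space n) m g \<xi> \<in> G n"
      unfolding operates_on_def by simp
  qed
  ultimately show "operating_semigroup (generated F)"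
    by (simp add: operating_semigroup_def)
qed

lemma closedin_induced_topology:
  assumes "contains_constants X (E :: ('x \<Rightarrow> 'k::field) set)"
    and Un: "\<And>S T. function_closed X E S \<Longrightarrow> function_closed X E T \<Longrightarrow> function_closed X E (S \<union> T)"
  shows "closedin (induced_topology X E) S \<longleftrightarrow> function_closed X E S"
proof -
  let ?L = "\<lambda>U. U \<subseteq> X \<and> function_closed X E (X - U)"
  have "istopology ?L"
    unfolding istopology_def
  proof (intro conjI allI impI)
    fix U V assume "?L U" "?L V"
    then have "function_closed X E ((X - U) \<union> (X - V))"
      using Un by blast
    then show "function_closed X E (X - U \<inter> V)"
      by (simp add: Diff_Int)
  next
    fix \<K> assume K: "\<forall>U\<in>\<K>. ?L U"
    show "function_closed X E (X - \<Union>\<K>)"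
      unfolding function_closed_def
    proof (intro conjI ballI)
      fix t assume "t \<in> X - (X - \<Union>\<K>)"
      then obtain U where U: "U \<in> \<K>" "t \<in> X - (X - U)"
        by blast
      then obtain \<xi> where "\<xi> \<in> E" "\<forall>s\<in>X - U. \<xi> s = 0" "\<xi> t \<noteq> 0"
        using K unfolding function_closed_def by blast
      then show "\<exists>\<xi>\<in>E. (\<forall>s\<in>X - \<Union>\<K>. \<xi> s = 0) \<and> \<xi> t \<noteq> 0"
        using U by blast
    qed auto
  qed (use assms in blast)+
  then have op: "openin (induced_topology X E) U \<longleftrightarrow> ?L U" for U
    by (simp add: induced_topology_def)
  have "on X (\<lambda>x. 1) \<in> E"
    using assms(1) by (auto simp: contains_constants_def)
  then have "function_closed X E {}"
    unfolding function_closed_def by (auto simp: on_def intro!: bexI[of _ "on X (\<lambda>x. 1)"])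
  then have "topspace (induced_topology X E) = X"
    unfolding topspace_def op by auto
  then show ?thesis
    unfolding closedin_def op by (auto simp: function_closed_def double_diff)
qed

lemma function_closed_Un:
  fixes E :: "('x \<Rightarrow> 'k::field) set"
  assumes E: "linear_subspace X E" and const: "contains_constants X E"
    and f: "operates_on n f X E" "\<not> additively_affine n f"
    and S: "function_closed X E S" and T: "function_closed X E T"
  shows "function_closed X E (S \<union> T)"
  unfolding function_closed_def
proof (intro conjI ballI)
  show "S \<union> T \<subseteq> X"
    using S T by (auto simp: function_closed_def)
  fix t assume t: "t \<in> X - (S \<union> T)"
  have sub: "fun_space.subspace E" and ext: "E \<subseteq> functions_on X"
    using E by (auto simp: linear_subspace_def)
  have unit: "\<exists>\<xi>\<in>E. (\<forall>s\<in>R. \<xi> s = 0) \<and> \<xi> t = 1" if R: "function_closed X E R" "t \<notin> R" for R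
  proof -
    obtain \<xi> where \<xi>: "\<xi> \<in> E" "\<forall>s\<in>R. \<xi> s = 0" "\<xi> t \<noteq> 0"
      using R t unfolding function_closed_def by blast
    then show ?thesis
      by (intro bexI[of _ "fun_scale (inverse (\<xi> t)) \<xi>"] fun_space.subspace_scale[OF sub])
        (auto simp: fun_scale_def)
  qed
  obtain \<xi> where \<xi>: "\<xi> \<in> E" "\<forall>s\<in>S. \<xi> s = 0" "\<xi> t = 1"
    using unit[OF S] t by blast
  obtain \<eta> where \<eta>: "\<eta> \<in> E" "\<forall>s\<in>T. \<eta> s = 0" "\<eta> t = 1"
    using unit[OF T] t by blast
  obtain a b where a: "a \<in> power_space n" and b: "b \<in> power_space n"
    and ab: "f (a + b) - f a - f b + f 0 \<noteq> 0"
  proof (rule ccontr)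
    assume "\<not> thesis"
    then have "f (a + b) - f a - f b + f 0 = 0" if "a \<in> power_space n" "b \<in> power_space n" for a b
      using that \<open>\<And>b a. a \<in> power_space n \<Longrightarrow> b \<in> power_space n \<Longrightarrow>
        f (a + b) - f a - f b + f 0 \<noteq> 0 \<Longrightarrow> thesis\<close> by blast
    then have "\<forall>a\<in>power_space n. \<forall>b\<in>power_space n. f (a + b) - f 0 = (f a - f 0) + (f b - f 0)"
      by (simp add: algebra_simps)
    then have "additively_affine n f"
      unfolding additively_affine_def
      by (intro exI[of _ "f 0"] exI[of _ "\<lambda>x. f x - f 0"]) auto
    with f show False by blast
  qed
  define p where "p i = fun_scale (a i) \<xi>" for i
  define q where "q i = fun_scale (b i) \<eta>" for i
  define A where "A u = apply_op X n f u" for u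
  define \<zeta> where "\<zeta> = A (\<lambda>i. p i + q i) - A p - A q + A (\<lambda>i. 0)"
  have pq: "p i \<in> E" "q i \<in> E" for i
    by (auto simp: p_def q_def \<xi> \<eta> intro: fun_space.subspace_scale[OF sub])
  have A: "A u \<in> E" if "\<And>i. u i \<in> E" for u
    using f(1) that unfolding A_def operates_on_def by blast
  have "A (\<lambda>i. p i + q i) \<in> E"
    by (rule A) (rule fun_space.subspace_add[OF sub pq])
  moreover have "A (\<lambda>i. 0) \<in> E"
    by (rule A) (rule fun_space.subspace_0[OF sub])
  ultimately have "\<zeta> \<in> E"
    unfolding \<zeta>_def
    by (intro fun_space.subspace_add[OF sub] fun_space.subspace_diff[OF sub]
        fun_space.subspace_0[OF sub] A pq)
  moreover have val: "\<zeta> s = f (tuple n (\<lambda>i. p i + q i) s) - f (tuple n p s) - f (tuple n q s) + f 0"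
    if "s \<in> X" for s
  proof -
    have "tuple n (\<lambda>i. 0) s = (0 :: nat \<Rightarrow> 'k)"
      by (simp add: tuple_def on_def fun_eq_iff)
    then show ?thesis
      using that by (simp add: \<zeta>_def A_def apply_op_def on_def)
  qed
  moreover have "\<zeta> s = 0" if "s \<in> S \<union> T" for s
  proof -
    have "s \<in> X"
      using that S T by (auto simp: function_closed_def)
    consider "s \<in> S" | "s \<in> T"
      using \<open>s \<in> S \<union> T\<close> by blast
    then show ?thesis
    proof cases
      case 1
      then have "tuple n p s = 0" "tuple n (\<lambda>i. p i + q i) s = tuple n q s"
        using \<xi> by (simp_all add: tuple_def on_def p_def fun_scale_def fun_eq_iff)
      then show ?thesis
        using val[OF \<open>s \<in> X\<close>] by simp
    next
      case 2
      then have "tuple n q s = 0" "tuple n (\<lambda>i. p i + q i) s = tuple n p s"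
        using \<eta> by (simp_all add: tuple_def on_def q_def fun_scale_def fun_eq_iff)
      then show ?thesis
        using val[OF \<open>s \<in> X\<close>] by simp
    qed
  qed
  moreover have "\<zeta> t \<noteq> 0"
  proof -
    have "tuple n p t = a" "tuple n q t = b" "tuple n (\<lambda>i. p i + q i) t = a + b"
      using a b \<xi>(3) \<eta>(3)
      by (simp_all add: tuple_def on_def p_def q_def fun_scale_def functions_on_def fun_eq_iff)
    then show ?thesis
      using ab val[of t] t by simp
  qed
  ultimately show "\<exists>\<zeta>\<in>E. (\<forall>s\<in>S \<union> T. \<zeta> s = 0) \<and> \<zeta> t \<noteq> 0"
    by blast
qed

end

theory Submission
  imports Defs
begin

text \<open>
  The operations \<open>g\<close> that operate on \<open>E\<close> and commute with \<open>\<phi>\<close> form an operating semigroup containing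
  \<open>F\<close>, so they include \<open>G(F)\<close>. If the image tuple left \<open>S\<close> at some point \<open>t'\<close>, a function \<open>g \<in> G(F)\<^sub>n\<close>
  would vanish on \<open>S\<close> but not there; then \<open>g(\<xi>\<^sub>1, \<dots>, \<xi>\<^sub>n) = 0\<close>, whence
  \<open>g(\<phi>(\<xi>\<^sub>1), \<dots>, \<phi>(\<xi>\<^sub>n)) = \<phi>(0) = 0\<close>, a contradiction at \<open>t'\<close>.
\<close>

lemma on_in_functions_on: "on X f \<in> functions_on X"
  by (simp add: on_def functions_on_def)

text \<open>Operations on functions are always evaluated at such points, so the cut-off by
  \<open>on (power_space n)\<close> in constants, coordinates and composites is never felt.\<close>

lemma tuple_in_power_space: "tuple n \<xi> t \<in> power_space n"
  by (simp add: tuple_def on_in_functions_on)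

lemma apply_op_cong:
  "(\<And>i. i < n \<Longrightarrow> \<xi> i = \<eta> i) \<Longrightarrow> apply_op X n f \<xi> = apply_op X n f \<eta>"
  by (auto simp: apply_op_def tuple_def on_def intro!: ext arg_cong[of _ _ f])

lemma apply_op_0: "apply_op X n 0 \<xi> = 0"
  by (simp add: apply_op_def on_def fun_eq_iff)

lemma apply_op_add: "apply_op X n (f + g) \<xi> = apply_op X n f \<xi> + apply_op X n g (\<xi> :: nat \<Rightarrow> 'x \<Rightarrow> 'k::field)"
  by (simp add: apply_op_def on_def fun_eq_iff)

lemma apply_op_scale: "apply_op X n (fun_scale c f) \<xi> = fun_scale c (apply_op X n f \<xi>)"
  by (simp add: apply_op_def on_def fun_scale_def fun_eq_iff)

lemma apply_op_const: "apply_op X n (on (power_space n) (\<lambda>x. c)) \<xi> = on X (\<lambda>x. c)"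
  using tuple_in_power_space[of n \<xi>] by (auto simp: apply_op_def on_def fun_eq_iff)

text \<open>The left side is cut off outside \<open>X\<close>, so \<open>\<xi> i\<close> must vanish
  there for the two to agree.\<close>

lemma apply_op_coordinate:
  assumes "i < n" and "\<xi> i \<in> functions_on X"
  shows "apply_op X n (on (power_space n) (\<lambda>x. x i)) \<xi> = \<xi> i"
proof
  fix t
  show "apply_op X n (on (power_space n) (\<lambda>x. x i)) \<xi> t = \<xi> i t"
    using assms tuple_in_power_space[of n \<xi> t]
    by (auto simp: apply_op_def on_def functions_on_def tuple_def)
qed

text \<open>Associativity of superposition; it is what makes \<open>hom_operations\<close> closed
  under composition.\<close>

lemma apply_op_comp:
  "apply_op X n (apply_op (power_space n) m g h) \<xi> = apply_op X m g (\<lambda>i. apply_op X n (h i) \<xi>)"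
proof
  fix t
  show "apply_op X n (apply_op (power_space n) m g h) \<xi> t =
      apply_op X m g (\<lambda>i. apply_op X n (h i) \<xi>) t"
    using tuple_in_power_space[of n \<xi> t]
    by (simp add: apply_op_def on_def tuple_def[of m] cong: if_cong)
qed

text \<open>Preserving \<open>E\<close> is demanded together with commuting with
  \<open>\<phi>\<close>: in a composite, the inner results must lie in \<open>E\<close> before the
  condition on the outer operation applies to them.\<close>

definition hom_operations ::
  "'x set \<Rightarrow> ('x \<Rightarrow> 'k) set \<Rightarrow> 'y set \<Rightarrow> (('x \<Rightarrow> 'k) \<Rightarrow> ('y \<Rightarrow> 'k)) \<Rightarrow> 'k::field operations" where
  "hom_operations X E Y \<phi> n = {g \<in> functions_on (power_space n). \<forall>\<xi>. (\<forall>i<n. \<xi> i \<in> E) \<longrightarrow>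
     apply_op X n g \<xi> \<in> E \<and> \<phi> (apply_op X n g \<xi>) = apply_op Y n g (\<lambda>i. \<phi> (\<xi> i))}"

text \<open>Linearity of \<open>\<phi>\<close> handles sums and scalar multiples, unitality the
  constants. The coordinates work because members of \<open>E\<close> and \<open>E'\<close> vanish
  outside \<open>X\<close> and \<open>Y\<close>.\<close>

lemma operating_semigroup_hom_operations:
  assumes E: "linear_subspace X E" "contains_constants X E"
    and E': "linear_subspace Y E'"
    and \<phi>: "unital_hom F X E Y E' \<phi>"
  shows "operating_semigroup (hom_operations X E Y \<phi>)"
proof -
  let ?H = "hom_operations X E Y \<phi>"
  have sub: "fun_space.subspace E" and ext: "\<And>\<xi>. \<xi> \<in> E \<Longrightarrow> \<xi> \<in> functions_on X"
    using E(1) by (auto simp: linear_subspace_def)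
  have add: "\<phi> (\<xi> + \<eta>) = \<phi> \<xi> + \<phi> \<eta>" if "\<xi> \<in> E" "\<eta> \<in> E" for \<xi> \<eta>
    using \<phi> that by (simp add: unital_hom_def)
  have scale: "\<phi> (fun_scale c \<xi>) = fun_scale c (\<phi> \<xi>)" if "\<xi> \<in> E" for c \<xi>
    using \<phi> that by (simp add: unital_hom_def)
  have one: "\<phi> (on X (\<lambda>x. 1)) = on Y (\<lambda>y. 1)"
    using \<phi> by (simp add: unital_hom_def)
  have ext': "\<phi> \<xi> \<in> functions_on Y" if "\<xi> \<in> E" for \<xi>
    using \<phi> E' that by (auto simp: unital_hom_def linear_subspace_def)
  have const: "on Z (\<lambda>x. c) = fun_scale c (on Z (\<lambda>x. 1))" for Z :: "'z set" and c :: 'b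
    by (simp add: on_def fun_scale_def fun_eq_iff)
  have constE: "on X (\<lambda>x. c) \<in> E" for c
    using E(2) by (simp add: contains_constants_def)
  \<comment> \<open>A constant is a multiple of the function 1, whose image is known by
    unitality.\<close>
  have phi_const: "\<phi> (on X (\<lambda>x. c)) = on Y (\<lambda>y. c)" for c
    using scale[OF constE[of 1], of c] one const[of X c] const[of Y c] by simp
  have phi_0: "\<phi> 0 = 0"
    using phi_const[of 0] by (simp add: on_def zero_fun_def)
  have "linear_subspace (power_space n) (?H n)" for n
    unfolding linear_subspace_def
  proof
    show "fun_space.subspace (?H n)"
      unfolding fun_space.subspace_def
    proof (intro conjI ballI allI)
      show "0 \<in> ?H n"
        by (simp add: hom_operations_def apply_op_0 phi_0 fun_space.subspace_0[OF sub])
          (simp add: functions_on_def)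
    next
      fix g h assume "g \<in> ?H n" "h \<in> ?H n"
      then show "g + h \<in> ?H n"
        by (simp add: hom_operations_def apply_op_add add fun_space.subspace_add[OF sub])
          (simp add: functions_on_def)
    next
      fix c g assume "g \<in> ?H n"
      then show "fun_scale c g \<in> ?H n"
        by (simp add: hom_operations_def apply_op_scale scale fun_space.subspace_scale[OF sub])
          (simp add: functions_on_def fun_scale_def)
    qed
  qed (auto simp: hom_operations_def)
  moreover have "contains_constants (power_space n) (?H n)" for n
    unfolding contains_constants_def hom_operations_def
    by (simp add: apply_op_const constE phi_const on_in_functions_on)
  moreover have "on (power_space n) (\<lambda>x. x i) \<in> ?H n" if "i < n" for n i
    using that unfolding hom_operations_def
    by (simp add: apply_op_coordinate ext ext' on_in_functions_on)
  moreover have "operates_on m g (power_space n) (?H n)" if g: "g \<in> ?H m" for m n g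
    unfolding operates_on_def
  proof (intro allI impI)
    fix h assume h: "\<forall>i<m. h i \<in> ?H n"
    have "apply_op X n (apply_op (power_space n) m g h) \<xi> \<in> E \<and>
        \<phi> (apply_op X n (apply_op (power_space n) m g h) \<xi>) =
        apply_op Y n (apply_op (power_space n) m g h) (\<lambda>i. \<phi> (\<xi> i))"
      if \<xi>: "\<forall>i<n. \<xi> i \<in> E" for \<xi>
    proof -
      let ?\<eta> = "\<lambda>i. apply_op X n (h i) \<xi>"
      have \<eta>: "?\<eta> i \<in> E" "\<phi> (?\<eta> i) = apply_op Y n (h i) (\<lambda>i. \<phi> (\<xi> i))" if "i < m" for i
        using h that \<xi> by (auto simp: hom_operations_def)
      have "apply_op X m g ?\<eta> \<in> E" "\<phi> (apply_op X m g ?\<eta>) = apply_op Y m g (\<lambda>i. \<phi> (?\<eta> i))"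
        using g \<eta>(1) by (auto simp: hom_operations_def)
      \<comment> \<open>The inner \<open>h i\<close> commute with \<open>\<phi>\<close> only for
        \<open>i < m\<close>, which suffices as \<open>g\<close> ignores the later members.\<close>
      moreover have "apply_op Y m g (\<lambda>i. \<phi> (?\<eta> i)) =
          apply_op Y m g (\<lambda>i. apply_op Y n (h i) (\<lambda>i. \<phi> (\<xi> i)))"
        by (rule apply_op_cong) (rule \<eta>(2))
      ultimately show ?thesis
        by (simp add: apply_op_comp)
    qed
    then show "apply_op (power_space n) m g h \<in> ?H n"
      unfolding hom_operations_def by (simp add: apply_op_def[of "power_space n"] on_in_functions_on)
  qed
  ultimately show ?thesis
    by (simp add: operating_semigroup_def)
qed

text \<open>Minimality of \<open>generated F\<close> replaces an induction on how \<open>g\<close>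
  is built: stability of \<open>E\<close> and the homomorphism property place \<open>F\<close>
  inside \<open>hom_operations\<close>.\<close>

lemma unital_hom_generated:
  assumes F: "operation_set F"
    and E: "linear_subspace X E" "contains_constants X E" "stable_under F X E"
    and E': "linear_subspace Y E'"
    and \<phi>: "unital_hom F X E Y E' \<phi>"
    and g: "g \<in> generated F n" and \<xi>: "\<forall>i<n. \<xi> i \<in> E"
  shows "\<phi> (apply_op X n g \<xi>) = apply_op Y n g (\<lambda>i. \<phi> (\<xi> i))"
proof -
  have "F m \<subseteq> hom_operations X E Y \<phi> m" if "1 \<le> m" for m
  proof
    fix f assume f: "f \<in> F m"
    then have "f \<in> functions_on (power_space m)" "operates_on m f X E"
      using F E(3) that by (auto simp: operation_set_def stable_under_def)
    moreover have "\<phi> (apply_op X m f \<eta>) = apply_op Y m f (\<lambda>i. \<phi> (\<eta> i))"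
      if "\<forall>i<m. \<eta> i \<in> E" for \<eta>
      using \<phi> f \<open>1 \<le> m\<close> that unfolding unital_hom_def by simp
    ultimately show "f \<in> hom_operations X E Y \<phi> m"
      by (simp add: hom_operations_def operates_on_def)
  qed
  then have "g \<in> hom_operations X E Y \<phi> n"
    using operating_semigroup_generated(3)[OF F operating_semigroup_hom_operations[OF E(1,2) E' \<phi>]] g
    by blast
  then show ?thesis
    using \<xi> by (simp add: hom_operations_def)
qed

text \<open>The non-affine \<open>f\<close> belongs to \<open>generated F m\<close>, so it operates
  on \<open>generated F n\<close>; hence unions of closed sets are closed and the topology is the
  intended one.\<close>

lemma closedin_generated:
  assumes F: "operation_set F"
    and f: "1 \<le> m" "f \<in> F m" "\<not> additively_affine m f" and n: "1 \<le> n"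
  shows "closedin (induced_topology (power_space n) (generated F n)) S \<longleftrightarrow>
    function_closed (power_space n) (generated F n) S"
proof -
  have G: "linear_subspace (power_space n) (generated F n)"
    "contains_constants (power_space n) (generated F n)"
    "operates_on m f (power_space n) (generated F n)"
    using operating_semigroup_generated(1,2)[OF F] f(1,2) n
    unfolding operating_semigroup_def by blast+
  show ?thesis
    by (intro closedin_induced_topology G(2) function_closed_Un[OF G f(3)])
qed

theorem corollary4:
  fixes F :: "'k::field operations"
    and I :: "'i set" and E :: "('i \<Rightarrow> 'k) set"
    and I' :: "'j set" and E' :: "('j \<Rightarrow> 'k) set"
    and \<phi> :: "('i \<Rightarrow> 'k) \<Rightarrow> ('j \<Rightarrow> 'k)"
    and n :: nat and S :: "(nat \<Rightarrow> 'k) set" and \<xi> :: "nat \<Rightarrow> 'i \<Rightarrow> 'k"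
  assumes "operation_set F"
    and "\<exists>m\<ge>1. \<exists>f\<in>F m. \<not> additively_affine m f"
    and "linear_subspace I E" and "contains_constants I E" and "stable_under F I E"
    and "linear_subspace I' E'" and "contains_constants I' E'" and "stable_under F I' E'"
    and "unital_hom F I E I' E' \<phi>"
    and "n \<ge> 1"
    and "closedin (induced_topology (power_space n) (generated F n)) S"
    and "\<forall>i<n. \<xi> i \<in> E"
    and "\<forall>t\<in>I. tuple n \<xi> t \<in> S"
  shows "\<forall>t'\<in>I'. tuple n (\<lambda>i. \<phi> (\<xi> i)) t' \<in> S"
proof (rule ballI, rule ccontr)
  fix t' assume t': "t' \<in> I'" and notin: "tuple n (\<lambda>i. \<phi> (\<xi> i)) t' \<notin> S"
  have "function_closed (power_space n) (generated F n) S"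
    using assms(1,2,10,11) closedin_generated by blast
  moreover have "tuple n (\<lambda>i. \<phi> (\<xi> i)) t' \<in> power_space n - S"
    using notin tuple_in_power_space by simp
  ultimately obtain g where g: "g \<in> generated F n" "\<forall>s\<in>S. g s = 0"
      "g (tuple n (\<lambda>i. \<phi> (\<xi> i)) t') \<noteq> 0"
    unfolding function_closed_def by meson
  \<comment> \<open>Over \<open>I\<close> the tuples lie in \<open>S\<close>, where \<open>g\<close>
    vanishes; outside \<open>I\<close> both sides are 0 by convention.\<close>
  have "apply_op I n g \<xi> = apply_op I n 0 \<xi>"
    using g(2) assms(13) by (simp add: apply_op_def on_def fun_eq_iff)
  \<comment> \<open>Writing 0 as a multiple of the function 1, a member of \<open>E\<close>, lets
    homogeneity of \<open>\<phi>\<close> give the image 0.\<close>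
  also have "\<dots> = fun_scale 0 (on I (\<lambda>x. 1))"
    by (simp add: apply_op_0)
  finally have "\<phi> (apply_op I n g \<xi>) = fun_scale 0 (\<phi> (on I (\<lambda>x. 1)))"
    using assms(4,9) unfolding unital_hom_def contains_constants_def by metis
  then have "apply_op I' n g (\<lambda>i. \<phi> (\<xi> i)) = 0"
    using unital_hom_generated[OF assms(1,3,4,5,6,9) g(1) assms(12)] by simp
  then have "apply_op I' n g (\<lambda>i. \<phi> (\<xi> i)) t' = 0"
    by simp
  then show False
    using g(3) t' by (simp add: apply_op_def on_def)
qed

end
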